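(* Let $(A,\mathfrak{m},K)$ be a Noetherian local ring of dimension $d$, let $I$ be an $\mathfrak{m}$-primary ideal, let $Q=(x_1,\dots,x_d)$ be a parameter ideal of $A$ that is a reduction of $I$, and write $I=Q+(x_{d+1},\dots,x_n)$ with $n=\mu(I)$. Let $r$ be the reduction number of $I$ with respect to $Q$ and let $\varphi:K[X_1,\dots,X_n]\to\mathcal{F}(I)$, $X_i\mapsto\overline{x_i}t$, be the canonical surjection onto the fiber cone of $I$. Then, for each $2\le i\le r+1$ and each $x_{\ell_1}x_{\ell_2}\cdots x_{\ell_i}\in\operatorname{Gen}(I^i)\setminus\operatorname{MinGen}(I^i/QI^{i-1})$, the polynomial $Z_{\ell_1,\dots,\ell_i}$ constructed in the context (for any admissible choices) satisfies $Z_{\ell_1,\dots,\ell_i}\in\operatorname{Ker}\varphi$.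
   Context: Rings are commutative. $(A,\mathfrak{m},K)$ is a Noetherian local ring with maximal ideal $\mathfrak{m}$, residue field $K=A/\mathfrak{m}$, and dimension $d$; $\mu(M)$ denotes the minimal number of generators of a module $M$; $\overline{a}$ is the image of $a\in A$ in $K$. Fiber cone: with $t$ a variable, $\mathcal{R}(I)=A[It]\subseteq A[t]$ and $\mathcal{F}(I)=\mathcal{R}(I)/\mathfrak{m}\mathcal{R}(I)\cong\bigoplus_{i\ge0}I^i/\mathfrak{m}I^i$. For $z\in I^i$, $\overline{z}t^i$ denotes the image of $zt^i$ in $\mathcal{F}(I)$. Setting: $I$ is $\mathfrak{m}$-primary, $Q=(x_1,\dots,x_d)$ is a parameter ideal of $A$ with $Q\subseteq I$ and $I^{m+1}=QI^m$ for some $m>0$ (i.e. $Q$ is a reduction of $I$). Then $x_1,\dots,x_d$ is part of a minimal system of generators of $I$, and one writes $I=Q+(x_{d+1},\dots,x_n)$ with $n=\mu(I)$. The map $\varphi:K[X_1,\dots,X_n]\to\mathcal{F}(I)$ is the surjective $K$-algebra homomorphism with $X_i\mapsto\overline{x_i}t$. Let $r=\min\{m\ge0: I^{m+1}=QI^m\}$ be the reduction number of $I$ with respect to $Q$. For $i\ge1$ let $u_i=\mu(I^i/QI^{i-1})$ (so $u_i=0$ for $i\ge r+1$) and $$\operatorname{Gen}(I^i)=\{x_{\ell_1}x_{\ell_2}\cdots x_{\ell_i}: 1\le\ell_s\le n\text{ for }1\le s\le i\}.$$ For each $i\ge2$ choose $y_{i1},\dots,y_{iu_i}\in\operatorname{Gen}(I^i)$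 whose images form a minimal system of generators of $I^i/QI^{i-1}$, and set $\operatorname{MinGen}(I^i/QI^{i-1})=\{y_{i1},\dots,y_{iu_i}\}$ (empty if $i\ge r+1$). For each $j$ choose a monomial $Y_{ij}$ of degree $i$ in $K[X_1,\dots,X_n]$ with $\varphi(Y_{ij})=\overline{y_{ij}}t^i$. Construction of $Z_{\ell_1,\dots,\ell_i}$: for each $2\le i\le r+1$ and each tuple $(\ell_1,\dots,\ell_i)$ with $1\le\ell_s\le n$ and $x_{\ell_1}\cdots x_{\ell_i}\in\operatorname{Gen}(I^i)\setminus\operatorname{MinGen}(I^i/QI^{i-1})$, choose $a_j\in A$ and $b_{p,q_1,\dots,q_{i-1}}\in A$ (depending on the tuple) such that $$x_{\ell_1}\cdots x_{\ell_i}-\sum_{j=1}^{u_i}a_jy_{ij}=\sum_{1\le p\le d,\;1\le q_1,\dots,q_{i-1}\le n}b_{p,q_1,\dots,q_{i-1}}\,x_px_{q_1}\cdots x_{q_{i-1}};$$ such elements exist. (For $i=r+1$ the sum over $j$ is empty.) Put $$Z_{\ell_1,\dots,\ell_i}=X_{\ell_1}\cdots X_{\ell_i}-\sum_{j=1}^{u_i}\overline{a_j}\,Y_{ij}-\sum_{1\le p\le d,\;1\le q_1,\dots,q_{i-1}\le n}\overline{b_{p,q_1,\dots,q_{i-1}}}\,X_pX_{q_1}\cdots X_{q_{i-1}}\in K[X_1,\dots,X_n].$$ *)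

theory Defs
  imports "HOL-Algebra.Algebra" "HOL-Algebra.Indexed_Polynomials" "HOL-Library.Extended_Nat"
begin

section \<open>Noetherian local rings, dimension, primary ideals\<close>

locale noetherian_local_ring = cring A + noetherian_ring A + maximalideal \<mm> A
  for A (structure) and \<mm> +
  assumes unique_maximal: "maximalideal J A \<Longrightarrow> J = \<mm>"

definition prime_chain :: "('a, 'b) ring_scheme \<Rightarrow> nat \<Rightarrow> (nat \<Rightarrow> 'a set) \<Rightarrow> bool" where
  "prime_chain A k P \<longleftrightarrow> (\<forall>j\<le>k. primeideal (P j) A) \<and> (\<forall>j<k. P j \<subset> P (Suc j))"

definition krull_dim :: "('a, 'b) ring_scheme \<Rightarrow> enat" where
  "krull_dim A = Sup {enat k |k. \<exists>P. prime_chain A k P}"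

definition ideal_radical :: "('a, 'b) ring_scheme \<Rightarrow> 'a set \<Rightarrow> 'a set" where
  "ideal_radical A J = {a \<in> carrier A. \<exists>k::nat. a [^]\<^bsub>A\<^esub> k \<in> J}"

definition primary_ideal :: "('a, 'b) ring_scheme \<Rightarrow> 'a set \<Rightarrow> bool" where
  "primary_ideal A J \<longleftrightarrow> ideal J A \<and> J \<noteq> carrier A \<and>
     (\<forall>a\<in>carrier A. \<forall>b\<in>carrier A.
        a \<otimes>\<^bsub>A\<^esub> b \<in> J \<longrightarrow> a \<in> J \<or> (\<exists>k::nat. b [^]\<^bsub>A\<^esub> k \<in> J))"

text \<open>\<open>is_primary_to A P J\<close>: the ideal \<open>J\<close> is \<open>P\<close>-primary.\<close>

definition is_primary_to :: "('a, 'b) ring_scheme \<Rightarrow> 'a set \<Rightarrow> 'a set \<Rightarrow> bool" where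
  "is_primary_to A P J \<longleftrightarrow> primary_ideal A J \<and> ideal_radical A J = P"

text \<open>\<open>x 1, \<dots>, x d\<close> is a system of parameters of the local ring \<open>(A, \<mm>)\<close>, so that the ideal
  generated by it is a parameter ideal.\<close>

definition system_of_parameters ::
    "('a, 'b) ring_scheme \<Rightarrow> 'a set \<Rightarrow> nat \<Rightarrow> (nat \<Rightarrow> 'a) \<Rightarrow> bool" where
  "system_of_parameters A \<mm> d x \<longleftrightarrow>
     krull_dim A = enat d \<and> x ` {1..d} \<subseteq> carrier A \<and>
     is_primary_to A \<mm> (Idl\<^bsub>A\<^esub> (x ` {1..d}))"


section \<open>Generators of modules\<close>

definition generates_module ::
    "('a, 'b) ring_scheme \<Rightarrow> ('a, 'c, 'd) module_scheme \<Rightarrow> 'c set \<Rightarrow> bool" where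
  "generates_module A M S \<longleftrightarrow>
     S \<subseteq> carrier M \<and> (\<forall>N. submodule N A M \<and> S \<subseteq> N \<longrightarrow> N = carrier M)"

text \<open>Meaningful for finitely generated modules only.\<close>

definition min_num_gens :: "('a, 'b) ring_scheme \<Rightarrow> ('a, 'c, 'd) module_scheme \<Rightarrow> nat" where
  "min_num_gens A M = (LEAST k. \<exists>S. finite S \<and> card S = k \<and> generates_module A M S)"

definition min_gen_system ::
    "('a, 'b) ring_scheme \<Rightarrow> ('a, 'c, 'd) module_scheme \<Rightarrow> nat \<Rightarrow> (nat \<Rightarrow> 'c) \<Rightarrow> bool" where
  "min_gen_system A M k g \<longleftrightarrow> generates_module A M (g ` {1..k}) \<and>
     (\<forall>J. J \<subset> {1..k} \<longrightarrow> \<not> generates_module A M (g ` J))"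

text \<open>An ideal \<open>J\<close>, and a quotient \<open>J / L\<close> of ideals \<open>L \<subseteq> J\<close>, as \<open>A\<close>-modules. The fields
  \<open>mult\<close> and \<open>one\<close> of the module record play no role.\<close>

definition ideal_module :: "('a, 'b) ring_scheme \<Rightarrow> 'a set \<Rightarrow> ('a, 'a) module" where
  "ideal_module A J =
     \<lparr>carrier = J, monoid.mult = (\<otimes>\<^bsub>A\<^esub>), one = \<one>\<^bsub>A\<^esub>, ring.zero = \<zero>\<^bsub>A\<^esub>, add = (\<oplus>\<^bsub>A\<^esub>), smult = (\<otimes>\<^bsub>A\<^esub>)\<rparr>"

definition quotient_module ::
    "('a, 'b) ring_scheme \<Rightarrow> 'a set \<Rightarrow> 'a set \<Rightarrow> ('a, 'a set) module" where
  "quotient_module A J L =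
     \<lparr>carrier = (\<lambda>z. L +>\<^bsub>A\<^esub> z) ` J, monoid.mult = rcoset_mult A L, one = L +>\<^bsub>A\<^esub> \<one>\<^bsub>A\<^esub>,
      ring.zero = L, add = set_add A, smult = (\<lambda>a C. \<Union>c\<in>C. L +>\<^bsub>A\<^esub> (a \<otimes>\<^bsub>A\<^esub> c))\<rparr>"


section \<open>Reductions\<close>

abbreviation ideal_pow :: "('a, 'b) ring_scheme \<Rightarrow> 'a set \<Rightarrow> nat \<Rightarrow> 'a set" where
  "ideal_pow A I k \<equiv> I [^]\<^bsub>ideals_set A\<^esub> k"

definition is_reduction :: "('a, 'b) ring_scheme \<Rightarrow> 'a set \<Rightarrow> 'a set \<Rightarrow> bool" where
  "is_reduction A Q I \<longleftrightarrow>
     Q \<subseteq> I \<and> (\<exists>k>0. ideal_pow A I (k + 1) = ideal_prod A Q (ideal_pow A I k))"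

definition reduction_number :: "('a, 'b) ring_scheme \<Rightarrow> 'a set \<Rightarrow> 'a set \<Rightarrow> nat" where
  "reduction_number A Q I =
     (LEAST k. ideal_pow A I (k + 1) = ideal_prod A Q (ideal_pow A I k))"

text \<open>The module \<open>I\<^sup>i / Q I\<^sup>i\<^sup>-\<^sup>1\<close> for \<open>i \<ge> 1\<close>, and its minimal number of generators \<open>u\<^sub>i\<close>.\<close>

definition red_quot ::
    "('a, 'b) ring_scheme \<Rightarrow> 'a set \<Rightarrow> 'a set \<Rightarrow> nat \<Rightarrow> ('a, 'a set) module" where
  "red_quot A Q I i =
     quotient_module A (ideal_pow A I i) (ideal_prod A Q (ideal_pow A I (i - 1)))"

definition u_num :: "('a, 'b) ring_scheme \<Rightarrow> 'a set \<Rightarrow> 'a set \<Rightarrow> nat \<Rightarrow> nat" where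
  "u_num A Q I i = min_num_gens A (red_quot A Q I i)"

abbreviation tuples :: "nat \<Rightarrow> nat \<Rightarrow> (nat \<Rightarrow> nat) set" where
  "tuples i n \<equiv> {1..i} \<rightarrow>\<^sub>E {1..n}"

definition Gen :: "('a, 'b) ring_scheme \<Rightarrow> nat \<Rightarrow> (nat \<Rightarrow> 'a) \<Rightarrow> nat \<Rightarrow> 'a set" where
  "Gen A n x i = {(\<Otimes>\<^bsub>A\<^esub>s\<in>{1..i}. x (l s)) |l. l \<in> tuples i n}"

text \<open>Empty for \<open>i\<close> above the reduction number, since then \<open>u\<^sub>i = 0\<close>.\<close>

definition MinGen ::
    "('a, 'b) ring_scheme \<Rightarrow> 'a set \<Rightarrow> 'a set \<Rightarrow> (nat \<Rightarrow> nat \<Rightarrow> 'a) \<Rightarrow> nat \<Rightarrow> 'a set" where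
  "MinGen A Q I y i = y i ` {1..u_num A Q I i}"


section \<open>Polynomial rings in several variables\<close>

text \<open>The ring of polynomials over \<open>K\<close> with variables indexed by \<open>V\<close>. Elements are the indexed
  polynomials of \<^theory>\<open>HOL-Algebra.Indexed_Polynomials\<close>, that is, functions from monomials
  (multisets of indices) to coefficients; that theory does not define a product of polynomials.\<close>

definition mpoly_ring :: "('k, 'b) ring_scheme \<Rightarrow> 'v set \<Rightarrow> ('v multiset \<Rightarrow> 'k) ring" where
  "mpoly_ring K V =
     \<lparr>carrier = ring.indexed_pset K V (carrier K),
      monoid.mult = (\<lambda>P Q w. \<Oplus>\<^bsub>K\<^esub>v\<in>{v. v \<subseteq># w}. P v \<otimes>\<^bsub>K\<^esub> Q (w - v)),
      one = ring.indexed_const K \<one>\<^bsub>K\<^esub>,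
      ring.zero = ring.indexed_const K \<zero>\<^bsub>K\<^esub>,
      add = ring.indexed_padd K\<rparr>"

definition mpoly_monomial :: "('k, 'b) ring_scheme \<Rightarrow> 'v multiset \<Rightarrow> ('v multiset \<Rightarrow> 'k)" where
  "mpoly_monomial K w = (\<lambda>v. if v = w then \<one>\<^bsub>K\<^esub> else \<zero>\<^bsub>K\<^esub>)"

definition monomials_of_degree ::
    "('k, 'b) ring_scheme \<Rightarrow> 'v set \<Rightarrow> nat \<Rightarrow> ('v multiset \<Rightarrow> 'k) set" where
  "monomials_of_degree K V i = {mpoly_monomial K w |w. set_mset w \<subseteq> V \<and> size w = i}"


section \<open>Rees algebra and fiber cone\<close>

text \<open>\<open>A[It] \<subseteq> A[t]\<close>, the \<open>A\<close>-subalgebra generated by \<open>I t\<close>.\<close>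

definition rees_algebra :: "('a, 'b) ring_scheme \<Rightarrow> 'a set \<Rightarrow> ('a, nat \<Rightarrow> 'a) up_ring" where
  "rees_algebra A I = (UP A)\<lparr>carrier := generate_ring (UP A)
     ({up_ring.monom (UP A) a 0 |a. a \<in> carrier A} \<union> {up_ring.monom (UP A) z 1 |z. z \<in> I})\<rparr>"

text \<open>The extended ideal \<open>\<mm> A[It]\<close>.\<close>

definition rees_max_ext :: "('a, 'b) ring_scheme \<Rightarrow> 'a set \<Rightarrow> 'a set \<Rightarrow> (nat \<Rightarrow> 'a) set" where
  "rees_max_ext A \<mm> I = Idl\<^bsub>rees_algebra A I\<^esub> {up_ring.monom (UP A) a 0 |a. a \<in> \<mm>}"

definition fiber_cone :: "('a, 'b) ring_scheme \<Rightarrow> 'a set \<Rightarrow> 'a set \<Rightarrow> (nat \<Rightarrow> 'a) set ring" where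
  "fiber_cone A \<mm> I = rees_algebra A I Quot rees_max_ext A \<mm> I"

text \<open>For \<open>z \<in> I\<^sup>i\<close>, the image of \<open>z t\<^sup>i\<close> in the fiber cone.\<close>

definition fiber_elt ::
    "('a, 'b) ring_scheme \<Rightarrow> 'a set \<Rightarrow> 'a set \<Rightarrow> 'a \<Rightarrow> nat \<Rightarrow> (nat \<Rightarrow> 'a) set" where
  "fiber_elt A \<mm> I z i =
     rees_max_ext A \<mm> I +>\<^bsub>rees_algebra A I\<^esub> up_ring.monom (UP A) z i"

abbreviation residue_field :: "('a, 'b) ring_scheme \<Rightarrow> 'a set \<Rightarrow> 'a set ring" where
  "residue_field A \<mm> \<equiv> A Quot \<mm>"

abbreviation KX :: "('a, 'b) ring_scheme \<Rightarrow> 'a set \<Rightarrow> nat \<Rightarrow> (nat multiset \<Rightarrow> 'a set) ring" where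
  "KX A \<mm> n \<equiv> mpoly_ring (residue_field A \<mm>) {1..n}"

abbreviation Xvar :: "('a, 'b) ring_scheme \<Rightarrow> 'a set \<Rightarrow> nat \<Rightarrow> (nat multiset \<Rightarrow> 'a set)" where
  "Xvar A \<mm> j \<equiv> ring.indexed_var (residue_field A \<mm>) j"

abbreviation res_const :: "('a, 'b) ring_scheme \<Rightarrow> 'a set \<Rightarrow> 'a \<Rightarrow> (nat multiset \<Rightarrow> 'a set)" where
  "res_const A \<mm> a \<equiv> ring.indexed_const (residue_field A \<mm>) (\<mm> +>\<^bsub>A\<^esub> a)"

text \<open>The \<open>K\<close>-algebra homomorphism \<open>K[X\<^sub>1, \<dots>, X\<^sub>n] \<rightarrow> F(I)\<close> with \<open>X\<^sub>j \<mapsto> x\<^sub>j t\<close>. The conditions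
  determine \<open>\<phi>\<close> on the carrier; the second one is \<open>K\<close>-linearity, as \<open>K\<close> acts on the fiber cone
  through \<open>A \<rightarrow> A[It]\<close>.\<close>

definition is_canonical_map ::
    "('a, 'b) ring_scheme \<Rightarrow> 'a set \<Rightarrow> 'a set \<Rightarrow> nat \<Rightarrow> (nat \<Rightarrow> 'a) \<Rightarrow>
      ((nat multiset \<Rightarrow> 'a set) \<Rightarrow> (nat \<Rightarrow> 'a) set) \<Rightarrow> bool" where
  "is_canonical_map A \<mm> I n x \<phi> \<longleftrightarrow>
     \<phi> \<in> ring_hom (KX A \<mm> n) (fiber_cone A \<mm> I) \<and>
     (\<forall>a\<in>carrier A. \<phi> (res_const A \<mm> a) = fiber_elt A \<mm> I a 0) \<and>
     (\<forall>j\<in>{1..n}. \<phi> (Xvar A \<mm> j) = fiber_elt A \<mm> I (x j) 1)"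


section \<open>The polynomials \<open>Z\<close>\<close>

text \<open>\<open>a\<close> and \<open>b\<close> are coefficients expressing that \<open>x\<^bsub>l 1\<^esub> \<cdots> x\<^bsub>l i\<^esub> - \<Sum>\<^sub>j a\<^sub>j y\<^sub>i\<^sub>j\<close> lies in
  \<open>Q I\<^sup>i\<^sup>-\<^sup>1\<close>.\<close>

definition admissible_coeffs ::
    "('a, 'b) ring_scheme \<Rightarrow> 'a set \<Rightarrow> 'a set \<Rightarrow> nat \<Rightarrow> nat \<Rightarrow> (nat \<Rightarrow> 'a) \<Rightarrow> (nat \<Rightarrow> nat \<Rightarrow> 'a) \<Rightarrow>
      nat \<Rightarrow> (nat \<Rightarrow> nat) \<Rightarrow> (nat \<Rightarrow> 'a) \<Rightarrow> (nat \<Rightarrow> (nat \<Rightarrow> nat) \<Rightarrow> 'a) \<Rightarrow> bool" where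
  "admissible_coeffs A Q I d n x y i l a b \<longleftrightarrow>
     (\<forall>j\<in>{1..u_num A Q I i}. a j \<in> carrier A) \<and>
     (\<forall>p\<in>{1..d}. \<forall>q\<in>tuples (i - 1) n. b p q \<in> carrier A) \<and>
     (\<Otimes>\<^bsub>A\<^esub>s\<in>{1..i}. x (l s)) \<ominus>\<^bsub>A\<^esub> (\<Oplus>\<^bsub>A\<^esub>j\<in>{1..u_num A Q I i}. a j \<otimes>\<^bsub>A\<^esub> y i j) =
     (\<Oplus>\<^bsub>A\<^esub>p\<in>{1..d}. \<Oplus>\<^bsub>A\<^esub>q\<in>tuples (i - 1) n.
        b p q \<otimes>\<^bsub>A\<^esub> (x p \<otimes>\<^bsub>A\<^esub> (\<Otimes>\<^bsub>A\<^esub>s\<in>{1..i - 1}. x (q s))))"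

definition Zpoly ::
    "('a, 'b) ring_scheme \<Rightarrow> 'a set \<Rightarrow> 'a set \<Rightarrow> 'a set \<Rightarrow> nat \<Rightarrow> nat \<Rightarrow>
      (nat \<Rightarrow> nat \<Rightarrow> (nat multiset \<Rightarrow> 'a set)) \<Rightarrow> nat \<Rightarrow> (nat \<Rightarrow> nat) \<Rightarrow>
      (nat \<Rightarrow> 'a) \<Rightarrow> (nat \<Rightarrow> (nat \<Rightarrow> nat) \<Rightarrow> 'a) \<Rightarrow> (nat multiset \<Rightarrow> 'a set)" where
  "Zpoly A \<mm> Q I d n Y i l a b =
     (\<Otimes>\<^bsub>KX A \<mm> n\<^esub>s\<in>{1..i}. Xvar A \<mm> (l s))
     \<ominus>\<^bsub>KX A \<mm> n\<^esub> (\<Oplus>\<^bsub>KX A \<mm> n\<^esub>j\<in>{1..u_num A Q I i}. res_const A \<mm> (a j) \<otimes>\<^bsub>KX A \<mm> n\<^esub> Y i j)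
     \<ominus>\<^bsub>KX A \<mm> n\<^esub> (\<Oplus>\<^bsub>KX A \<mm> n\<^esub>p\<in>{1..d}. \<Oplus>\<^bsub>KX A \<mm> n\<^esub>q\<in>tuples (i - 1) n.
        res_const A \<mm> (b p q) \<otimes>\<^bsub>KX A \<mm> n\<^esub>
          (Xvar A \<mm> p \<otimes>\<^bsub>KX A \<mm> n\<^esub> (\<Otimes>\<^bsub>KX A \<mm> n\<^esub>s\<in>{1..i - 1}. Xvar A \<mm> (q s))))"

end

theory Submission
  imports Defs
begin

text \<open>The polynomial \<open>Z\<close> is built from a relation in \<open>A\<close> by replacing each \<open>x\<^sub>j\<close> with \<open>X\<^sub>j\<close>, each
  \<open>y\<^sub>i\<^sub>j\<close> with \<open>Y\<^sub>i\<^sub>j\<close> and each coefficient with its residue class. All terms of that relation are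
  homogeneous of degree \<open>i\<close> in the generators of \<open>I\<close>, so \<open>\<phi>\<close> sends every term of \<open>Z\<close> to the class
  in the fiber cone of \<open>z t\<^sup>i\<close>, where \<open>z\<close> is the corresponding term in \<open>A\<close>. For fixed \<open>i\<close> the
  assignment of this class to \<open>z\<close> is additive, hence \<open>\<phi> Z\<close> is the class of \<open>0 t\<^sup>i\<close>.

  Two ingredients make this precise. First, a ring homomorphism commutes with the finite sums,
  finite products and differences that occur in \<open>Z\<close> only because the polynomials form a
  commutative ring; this is \<open>mpoly_ring_cring\<close>, whose main point is the associativity of
  convolution. Second, the class of \<open>z t\<^sup>i\<close> is compatible with the operations of \<open>A\<close> as long as
  \<open>z t\<^sup>i\<close> lies in the Rees algebra: sums keep the degree and products add the degrees
  (\<open>fib_finsum\<close>, \<open>fib_mult\<close>, \<open>fib_finprod\<close>).\<close>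

section \<open>Polynomial rings in several variables are commutative rings\<close>

lemma finite_submultisets: "finite {v. v \<subseteq># (w :: 'c multiset)}"
proof (induction w)
  case (add x w)
  have "{v. v \<subseteq># add_mset x w} \<subseteq> {v. v \<subseteq># w} \<union> add_mset x ` {v. v \<subseteq># w}"
  proof
    fix v assume "v \<in> {v. v \<subseteq># add_mset x w}"
    then have v: "v \<subseteq># add_mset x w" by simp
    show "v \<in> {v. v \<subseteq># w} \<union> add_mset x ` {v. v \<subseteq># w}"
    proof (cases "x \<in># v")
      case True
      then obtain u where "v = add_mset x u"
        by (metis insert_DiffM)
      with v show ?thesis by simp
    next
      case False
      with v have "v \<subseteq># w"
        by (metis add_mset_remove_trivial diff_single_trivial subset_eq_diff_conv
            union_mset_add_mset_right add_0_right)
      then show ?thesis by simp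
    qed
  qed
  with add.IH show ?case
    by (meson finite_UnI finite_imageI finite_subset)
qed simp

definition (in ring) indexed_mult ::
    "('c multiset \<Rightarrow> 'a) \<Rightarrow> ('c multiset \<Rightarrow> 'a) \<Rightarrow> ('c multiset \<Rightarrow> 'a)" where
  "indexed_mult P Q = (\<lambda>w. \<Oplus>\<^bsub>R\<^esub>v\<in>{v. v \<subseteq># w}. P v \<otimes> Q (w - v))"

lemma (in ring) mpoly_ring_simps:
  "carrier (mpoly_ring R V) = indexed_pset V (carrier R)"
  "P \<otimes>\<^bsub>mpoly_ring R V\<^esub> Q = indexed_mult P Q"
  "\<one>\<^bsub>mpoly_ring R V\<^esub> = indexed_const \<one>"
  "\<zero>\<^bsub>mpoly_ring R V\<^esub> = indexed_const \<zero>"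
  "P \<oplus>\<^bsub>mpoly_ring R V\<^esub> Q = indexed_padd P Q"
  by (simp_all add: mpoly_ring_def indexed_mult_def)

context cring
begin

lemma indexed_pset_coeff:
  "P \<in> indexed_pset V (carrier R) \<Longrightarrow> P w \<in> carrier R"
  using indexed_pset_in_carrier[of "carrier R" P V] by (simp add: carrier_coeff_def)

lemma indexed_const_coeff: "k \<in> carrier R \<Longrightarrow> carrier_coeff (indexed_const k)"
  by (simp add: carrier_coeff_def indexed_const_def)

lemma indexed_mult_coeff:
  assumes "carrier_coeff P" "carrier_coeff Q"
  shows "carrier_coeff (indexed_mult P Q)"
  using assms unfolding carrier_coeff_def indexed_mult_def by (auto intro!: finsum_closed)

text \<open>The involution \<open>v \<mapsto> w - v\<close> of the submultisets of \<open>w\<close> exchanges the two factors in the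
  convolution sum.\<close>

lemma indexed_mult_comm:
  fixes P Q :: "'c multiset \<Rightarrow> 'a"
  assumes "carrier_coeff P" "carrier_coeff Q"
  shows "indexed_mult P Q = indexed_mult Q P"
proof
  fix w :: "'c multiset"
  note [simp] = assms[unfolded carrier_coeff_def, rule_format]
  let ?S = "{v. v \<subseteq># w}"
  have inv: "w - (w - v) = v" if "v \<in> ?S" for v
    using that by (simp add: subset_mset.diff_diff_right)
  have img: "(\<lambda>v. w - v) ` ?S = ?S"
    using inv by (auto simp: image_iff) (metis diff_subset_eq_self)
  have inj: "inj_on (\<lambda>v. w - v) ?S"
    using inv by (metis inj_onI)
  have "indexed_mult P Q w = (\<Oplus>\<^bsub>R\<^esub>v\<in>(\<lambda>v. w - v) ` ?S. P v \<otimes> Q (w - v))"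
    by (simp add: indexed_mult_def img)
  also have "\<dots> = (\<Oplus>\<^bsub>R\<^esub>v\<in>?S. P (w - v) \<otimes> Q (w - (w - v)))"
    by (rule finsum_reindex[OF _ inj]) simp
  also have "\<dots> = (\<Oplus>\<^bsub>R\<^esub>v\<in>?S. Q v \<otimes> P (w - v))"
    by (rule finsum_cong') (auto simp: inv m_comm)
  finally show "indexed_mult P Q w = indexed_mult Q P w"
    by (simp add: indexed_mult_def)
qed

lemma indexed_mult_padd_right:
  assumes "carrier_coeff P" "carrier_coeff Q" "carrier_coeff Q'"
  shows "indexed_mult P (indexed_padd Q Q') = indexed_padd (indexed_mult P Q) (indexed_mult P Q')"
proof
  fix w
  note [simp] = assms[unfolded carrier_coeff_def, rule_format]
  show "indexed_mult P (indexed_padd Q Q') w =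
      indexed_padd (indexed_mult P Q) (indexed_mult P Q') w"
    by (simp add: indexed_mult_def indexed_padd_def r_distr finsum_addf Pi_def)
qed

lemma indexed_mult_const_right:
  assumes "carrier_coeff P" "k \<in> carrier R"
  shows "indexed_mult P (indexed_const k) = (\<lambda>w. P w \<otimes> k)"
proof
  fix w
  note [simp] = assms(1)[unfolded carrier_coeff_def, rule_format] assms(2)
  have "indexed_mult P (indexed_const k) w =
      (\<Oplus>\<^bsub>R\<^esub>v\<in>{v. v \<subseteq># w}. if w = v then P v \<otimes> k else \<zero>)"
    unfolding indexed_mult_def indexed_const_def
    by (rule finsum_cong') (auto simp: subset_mset.le_iff_add)
  also have "\<dots> = P w \<otimes> k"
    by (rule finsum_singleton) (auto simp: finite_submultisets)
  finally show "indexed_mult P (indexed_const k) w = P w \<otimes> k" .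
qed

text \<open>This is the induction step for closure and associativity. For \<open>w = add_mset i u\<close> the terms of
  the left-hand sum that survive are those whose complement \<open>w - v\<close> still contains \<open>i\<close>, that is,
  those with \<open>v \<subseteq># u\<close>.\<close>

lemma indexed_mult_pmult_right:
  assumes "carrier_coeff P" "carrier_coeff Q"
  shows "indexed_mult P (indexed_pmult Q i) = indexed_pmult (indexed_mult P Q) i"
proof
  fix w
  note [simp] = assms[unfolded carrier_coeff_def, rule_format]
  show "indexed_mult P (indexed_pmult Q i) w = indexed_pmult (indexed_mult P Q) i w"
  proof (cases "i \<in># w")
    case True
    then obtain u where w: "w = add_mset i u"
      by (metis insert_DiffM)
    have "(\<Oplus>\<^bsub>R\<^esub>v\<in>{v. v \<subseteq># w}. P v \<otimes> indexed_pmult Q i (w - v)) =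
        (\<Oplus>\<^bsub>R\<^esub>v\<in>{v. v \<subseteq># u}. P v \<otimes> Q (u - v))"
    proof (rule add.finprod_mono_neutral_cong_right)
      show "finite {v. v \<subseteq># w}" by (rule finite_submultisets)
      show "{v. v \<subseteq># u} \<subseteq> {v. v \<subseteq># w}"
        unfolding w by (auto intro: subset_mset.order_trans)
      show "P v \<otimes> indexed_pmult Q i (w - v) = P v \<otimes> Q (u - v)" if "v \<in> {v. v \<subseteq># u}" for v
      proof -
        have "u = v + (u - v)"
          using that by simp
        then obtain t where "u = v + t"
          by blast
        then have "w - v = add_mset i (u - v)"
          by (simp add: w)
        then show ?thesis by (simp add: indexed_pmult_def)
      qed
      show "P v \<otimes> indexed_pmult Q i (w - v) = \<zero>" if "v \<in> {v. v \<subseteq># w} - {v. v \<subseteq># u}" for v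
      proof -
        have "i \<notin># w - v"
        proof
          assume "i \<in># w - v"
          then obtain t where "w - v = add_mset i t"
            by (metis insert_DiffM)
          then have "w = v + add_mset i t"
            using that by (metis DiffD1 mem_Collect_eq subset_mset.add_diff_inverse)
          then have "u = v + t" by (simp add: w)
          with that show False by simp
        qed
        then show ?thesis by (simp add: indexed_pmult_def)
      qed
    qed (simp add: Pi_def indexed_pmult_def)
    then show ?thesis
      by (simp add: w indexed_mult_def indexed_pmult_def)
  next
    case False
    have "i \<notin># w - v" for v
      using False by (meson in_diffD)
    with False show ?thesis
      by (simp add: indexed_mult_def indexed_pmult_def)
  qed
qed

lemma indexed_mult_const_closed:
  fixes P :: "'c multiset \<Rightarrow> 'a"
  assumes "P \<in> indexed_pset V (carrier R)" "k \<in> carrier R"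
  shows "indexed_mult P (indexed_const k) \<in> indexed_pset V (carrier R)"
  using assms(1)
proof (induction rule: indexed_pset.induct)
  case (indexed_const k')
  have "(\<lambda>w. indexed_const k' w \<otimes> k) = (indexed_const (k' \<otimes> k) :: 'c multiset \<Rightarrow> 'a)"
    using assms(2) by (auto simp: indexed_const_def)
  with indexed_const assms(2) show ?case
    by (simp add: indexed_mult_const_right indexed_const_coeff indexed_pset.indexed_const)
next
  case (indexed_padd P Q)
  have "indexed_mult (indexed_padd P Q) (indexed_const k) =
      indexed_padd (indexed_mult P (indexed_const k)) (indexed_mult Q (indexed_const k))"
    using indexed_padd.hyps[THEN indexed_pset_coeff] assms(2)
    by (simp add: indexed_mult_const_right carrier_coeff_def indexed_padd_def l_distr)
  with indexed_padd.IH show ?case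
    by (simp add: indexed_pset.indexed_padd)
next
  case (indexed_pmult P i)
  have "indexed_mult (indexed_pmult P i) (indexed_const k) =
      indexed_pmult (indexed_mult P (indexed_const k)) i"
    using indexed_pmult.hyps(1)[THEN indexed_pset_coeff] assms(2)
    by (auto simp: indexed_mult_const_right carrier_coeff_def indexed_pmult_def)
  with indexed_pmult show ?case
    by (simp add: indexed_pset.indexed_pmult)
qed

lemma indexed_mult_closed:
  assumes "P \<in> indexed_pset V (carrier R)" "Q \<in> indexed_pset V (carrier R)"
  shows "indexed_mult P Q \<in> indexed_pset V (carrier R)"
  using assms(2)
proof (induction rule: indexed_pset.induct)
  case (indexed_const k)
  then show ?case by (rule indexed_mult_const_closed[OF assms(1)])
qed (use assms(1) in \<open>auto simp: indexed_mult_padd_right indexed_mult_pmult_right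
    indexed_pset_in_carrier[OF subset_refl] intro: indexed_pset.intros\<close>)

text \<open>Induction on the construction of the third factor avoids rearranging a double sum over
  chains of submultisets: every constructor commutes with left multiplication, so only a constant
  third factor needs a computation, and there associativity is distributivity over the sum.\<close>

lemma indexed_mult_assoc:
  assumes "carrier_coeff P" "carrier_coeff Q" "S \<in> indexed_pset V (carrier R)"
  shows "indexed_mult (indexed_mult P Q) S = indexed_mult P (indexed_mult Q S)"
  using assms(3)
proof (induction rule: indexed_pset.induct)
  case (indexed_const k)
  note [simp] = assms(1,2)[unfolded carrier_coeff_def, rule_format]
  have "indexed_mult P Q w \<otimes> k = indexed_mult P (\<lambda>w. Q w \<otimes> k) w" for w
    using indexed_const by (simp add: indexed_mult_def finsum_ldistr finite_submultisets m_assoc)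
  with indexed_const assms(1,2) show ?case
    by (simp add: indexed_mult_const_right indexed_mult_coeff)
qed (use assms(1,2) in \<open>simp_all add: indexed_mult_padd_right indexed_mult_pmult_right
    indexed_mult_coeff indexed_pset_in_carrier[OF subset_refl]\<close>)

lemma mpoly_ring_cring: "cring (mpoly_ring R V)"
proof (rule cringI)
  note [simp] = mpoly_ring_simps and [intro] = indexed_pset_in_carrier[OF subset_refl]
  show "abelian_group (mpoly_ring R V)"
  proof (rule abelian_groupI)
    fix P assume P: "P \<in> carrier (mpoly_ring R V)"
    then have c: "\<And>w. P w \<in> carrier R" by (auto dest: indexed_pset_coeff)
    \<comment> \<open>The inductive carrier is not given with negation; \<open>- P\<close> is obtained as \<open>P \<cdot> (- 1)\<close>.\<close>
    have "indexed_padd (indexed_mult P (indexed_const (\<ominus> \<one>))) P = indexed_const \<zero>"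
      using c by (simp add: indexed_mult_const_right carrier_coeff_def indexed_padd_def
          indexed_zero_def r_minus l_neg)
    with P show "\<exists>Q\<in>carrier (mpoly_ring R V). Q \<oplus>\<^bsub>mpoly_ring R V\<^esub> P = \<zero>\<^bsub>mpoly_ring R V\<^esub>"
      by (auto intro!: bexI[of _ "indexed_mult P (indexed_const (\<ominus> \<one>))"] indexed_mult_const_closed)
  qed (auto simp: indexed_padd_zero intro: indexed_pset.intros,
      auto simp: indexed_padd_def indexed_zero_def a_ac indexed_pset_coeff[of _ V] intro!: ext)
  show "comm_monoid (mpoly_ring R V)"
  proof (rule comm_monoidI)
    fix P assume P: "P \<in> carrier (mpoly_ring R V)"
    then have c: "carrier_coeff P" by auto
    then have "indexed_mult (indexed_const \<one>) P = indexed_mult P (indexed_const \<one>)"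
      by (simp add: indexed_mult_comm indexed_const_coeff)
    then show "\<one>\<^bsub>mpoly_ring R V\<^esub> \<otimes>\<^bsub>mpoly_ring R V\<^esub> P = P"
      using c by (simp add: indexed_mult_const_right carrier_coeffE)
  next
    show "P \<otimes>\<^bsub>mpoly_ring R V\<^esub> Q = Q \<otimes>\<^bsub>mpoly_ring R V\<^esub> P"
      if "P \<in> carrier (mpoly_ring R V)" "Q \<in> carrier (mpoly_ring R V)" for P Q
      using that by (auto intro!: indexed_mult_comm)
  qed (auto simp: indexed_mult_closed intro: indexed_pset.intros indexed_mult_assoc[where V = V])
  show "(P \<oplus>\<^bsub>mpoly_ring R V\<^esub> Q) \<otimes>\<^bsub>mpoly_ring R V\<^esub> S =
      P \<otimes>\<^bsub>mpoly_ring R V\<^esub> S \<oplus>\<^bsub>mpoly_ring R V\<^esub> Q \<otimes>\<^bsub>mpoly_ring R V\<^esub> S"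
    if "P \<in> carrier (mpoly_ring R V)" "Q \<in> carrier (mpoly_ring R V)"
       "S \<in> carrier (mpoly_ring R V)" for P Q S
  proof -
    have "carrier_coeff P" "carrier_coeff Q" "carrier_coeff S" using that by auto
    then show ?thesis
      by (simp add: indexed_mult_comm[of _ S] indexed_mult_padd_right indexed_padd_in_carrier)
  qed
qed

lemma const_in_mpoly_ring: "k \<in> carrier R \<Longrightarrow> indexed_const k \<in> carrier (mpoly_ring R V)"
  by (simp add: mpoly_ring_simps indexed_pset.indexed_const)

lemma var_in_mpoly_ring: "j \<in> V \<Longrightarrow> indexed_var j \<in> carrier (mpoly_ring R V)"
  by (simp add: mpoly_ring_simps indexed_var_def indexed_pset.intros)

lemma monomial_in_mpoly_ring:
  fixes w :: "'c multiset"
  assumes "set_mset w \<subseteq> V"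
  shows "mpoly_monomial R w \<in> carrier (mpoly_ring R V)"
  using assms
proof (induction w)
  case empty
  have "mpoly_monomial R ({#} :: 'c multiset) = indexed_const \<one>"
    by (simp add: mpoly_monomial_def indexed_const_def)
  then show ?case by (simp add: const_in_mpoly_ring)
next
  case (add j w)
  have "mpoly_monomial R (add_mset j w) = indexed_pmult (mpoly_monomial R w) j"
    by (auto simp: mpoly_monomial_def indexed_pmult_def fun_eq_iff)
  with add show ?case
    by (simp add: mpoly_ring_simps indexed_pset.indexed_pmult)
qed

end

section \<open>Homogeneous elements of the fiber cone\<close>

locale fiber_cone_setting = cring A for A (structure) +
  fixes \<mm> I
  assumes max_carrier: "\<mm> \<subseteq> carrier A" and I_carrier: "I \<subseteq> carrier A"
begin

sublocale UP: UP_cring A "UP A"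
  by unfold_locales

abbreviation Rees where "Rees \<equiv> rees_algebra A I"
abbreviation F where "F \<equiv> fiber_cone A \<mm> I"
abbreviation fib where "fib z i \<equiv> fiber_elt A \<mm> I z i"

lemma rees_generators_closed:
  "{up_ring.monom (UP A) a 0 |a. a \<in> carrier A} \<union> {up_ring.monom (UP A) z 1 |z. z \<in> I}
    \<subseteq> carrier (UP A)"
  using I_carrier by auto

lemma rees_ops:
  "f \<otimes>\<^bsub>Rees\<^esub> g = f \<otimes>\<^bsub>UP A\<^esub> g"
  "f \<oplus>\<^bsub>Rees\<^esub> g = f \<oplus>\<^bsub>UP A\<^esub> g"
  "\<one>\<^bsub>Rees\<^esub> = \<one>\<^bsub>UP A\<^esub>"
  "\<zero>\<^bsub>Rees\<^esub> = \<zero>\<^bsub>UP A\<^esub>"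
  by (simp_all add: rees_algebra_def)

sublocale Rees: cring Rees
proof -
  have "subcring (generate_ring (UP A) ({up_ring.monom (UP A) a 0 |a. a \<in> carrier A} \<union>
      {up_ring.monom (UP A) z 1 |z. z \<in> I})) (UP A)"
    by (rule UP.P.subcringI'[OF UP.P.generate_ring_is_subring[OF rees_generators_closed]])
  then show "cring Rees"
    unfolding rees_algebra_def
    using UP.P.subcring_iff[OF UP.P.generate_ring_incl[OF rees_generators_closed]] by simp
qed

text \<open>The degree \<open>i\<close> part of the Rees algebra, equal to \<open>I\<^sup>i\<close> if \<open>I\<close> is an ideal. Reading it off from
  membership in \<open>A[It]\<close> makes its closure properties immediate from those of a subring.\<close>

definition rees_part :: "nat \<Rightarrow> 'a set" where
  "rees_part i = {z \<in> carrier A. up_ring.monom (UP A) z i \<in> carrier Rees}"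

lemma rees_part_0: "z \<in> carrier A \<Longrightarrow> z \<in> rees_part 0"
  by (auto simp: rees_part_def rees_algebra_def intro: generate_ring.incl)

lemma rees_part_1: "z \<in> I \<Longrightarrow> z \<in> rees_part 1"
  using I_carrier by (auto simp: rees_part_def rees_algebra_def intro: generate_ring.incl)

lemma rees_part_mult:
  assumes "z \<in> rees_part i" "w \<in> rees_part j"
  shows "z \<otimes> w \<in> rees_part (i + j)"
  using assms Rees.m_closed by (fastforce simp: rees_part_def rees_ops)

lemma rees_part_add:
  assumes "z \<in> rees_part i" "w \<in> rees_part i"
  shows "z \<oplus> w \<in> rees_part i"
  using assms Rees.a_closed by (fastforce simp: rees_part_def rees_ops)

lemma rees_part_zero: "\<zero> \<in> rees_part i"
  using Rees.zero_closed by (simp add: rees_part_def rees_ops)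

lemma ideal_rees_max_ext: "ideal (rees_max_ext A \<mm> I) Rees"
  unfolding rees_max_ext_def
  using rees_part_0 max_carrier by (intro Rees.genideal_ideal) (auto simp: rees_part_def)

sublocale proj: ring_hom_cring Rees F "(+>\<^bsub>Rees\<^esub>) (rees_max_ext A \<mm> I)"
  unfolding fiber_cone_def
  by (rule ideal.rcos_ring_hom_cring[OF ideal_rees_max_ext Rees.cring_axioms])

lemma fib_closed: "z \<in> rees_part i \<Longrightarrow> fib z i \<in> carrier F"
  by (simp add: fiber_elt_def rees_part_def)

lemma fib_mult:
  assumes "z \<in> rees_part i" "w \<in> rees_part j"
  shows "fib (z \<otimes> w) (i + j) = fib z i \<otimes>\<^bsub>F\<^esub> fib w j"
  using assms by (simp add: fiber_elt_def rees_part_def flip: rees_ops)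

lemma fib_add:
  assumes "z \<in> rees_part i" "w \<in> rees_part i"
  shows "fib (z \<oplus> w) i = fib z i \<oplus>\<^bsub>F\<^esub> fib w i"
  using assms by (simp add: fiber_elt_def rees_part_def flip: rees_ops)

lemma fib_zero: "fib \<zero> i = \<zero>\<^bsub>F\<^esub>"
  by (simp add: fiber_elt_def flip: rees_ops)

text \<open>The degree is the same for all summands: \<open>fib\<close> is additive in each degree separately.\<close>

lemma fib_finsum:
  assumes "\<And>s. s \<in> S \<Longrightarrow> f s \<in> rees_part i"
  shows "(\<Oplus>\<^bsub>A\<^esub>s\<in>S. f s) \<in> rees_part i"
    and "fib (\<Oplus>\<^bsub>A\<^esub>s\<in>S. f s) i = (\<Oplus>\<^bsub>F\<^esub>s\<in>S. fib (f s) i)"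
proof -
  have "(\<Oplus>\<^bsub>A\<^esub>s\<in>S. f s) \<in> rees_part i \<and> fib (\<Oplus>\<^bsub>A\<^esub>s\<in>S. f s) i = (\<Oplus>\<^bsub>F\<^esub>s\<in>S. fib (f s) i)"
    using assms
  proof (induction S rule: infinite_finite_induct)
    case (insert t S)
    have "f \<in> S \<rightarrow> carrier A" "f t \<in> carrier A" "(\<lambda>s. fib (f s) i) \<in> S \<rightarrow> carrier F"
      using insert.prems fib_closed by (auto simp: rees_part_def)
    then show ?case
      using insert fib_closed by (simp add: rees_part_add fib_add)
  qed (simp_all add: rees_part_zero fib_zero)
  then show "(\<Oplus>\<^bsub>A\<^esub>s\<in>S. f s) \<in> rees_part i"
    and "fib (\<Oplus>\<^bsub>A\<^esub>s\<in>S. f s) i = (\<Oplus>\<^bsub>F\<^esub>s\<in>S. fib (f s) i)" by auto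
qed

text \<open>Each factor from \<open>I\<close> contributes one power of \<open>t\<close>, so the product lives in degree \<open>card S\<close>.\<close>

lemma fib_finprod:
  assumes "\<And>s. s \<in> S \<Longrightarrow> f s \<in> I" "finite S"
  shows "(\<Otimes>\<^bsub>A\<^esub>s\<in>S. f s) \<in> rees_part (card S)"
    and "fib (\<Otimes>\<^bsub>A\<^esub>s\<in>S. f s) (card S) = (\<Otimes>\<^bsub>F\<^esub>s\<in>S. fib (f s) 1)"
proof -
  have "(\<Otimes>\<^bsub>A\<^esub>s\<in>S. f s) \<in> rees_part (card S) \<and>
      fib (\<Otimes>\<^bsub>A\<^esub>s\<in>S. f s) (card S) = (\<Otimes>\<^bsub>F\<^esub>s\<in>S. fib (f s) 1)"
    using assms(2,1)
  proof (induction S rule: finite_induct)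
    case empty
    have "fib \<one> 0 = \<one>\<^bsub>F\<^esub>"
      by (simp add: fiber_elt_def flip: rees_ops)
    then show ?case by (simp add: rees_part_0)
  next
    case (insert t S)
    have "f \<in> S \<rightarrow> carrier A" "f t \<in> carrier A" "(\<lambda>s. fib (f s) 1) \<in> S \<rightarrow> carrier F"
      using insert.prems fib_closed[OF rees_part_1] I_carrier by auto
    then show ?case
      using insert fib_closed[OF rees_part_1]
        rees_part_mult[of "f t" 1 "\<Otimes>\<^bsub>A\<^esub>s\<in>S. f s" "card S"]
        fib_mult[of "f t" 1 "\<Otimes>\<^bsub>A\<^esub>s\<in>S. f s" "card S"] rees_part_1
      by simp
  qed
  then show "(\<Otimes>\<^bsub>A\<^esub>s\<in>S. f s) \<in> rees_part (card S)"
    and "fib (\<Otimes>\<^bsub>A\<^esub>s\<in>S. f s) (card S) = (\<Otimes>\<^bsub>F\<^esub>s\<in>S. fib (f s) 1)" by auto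
qed

end

section \<open>The polynomials \<open>Z\<close> lie in the kernel\<close>

theorem proposition2p6:
  fixes A :: "('a, 'b) ring_scheme"
    and \<mm> I Q :: "'a set"
    and x :: "nat \<Rightarrow> 'a"
    and d n :: nat
    and \<phi> :: "(nat multiset \<Rightarrow> 'a set) \<Rightarrow> (nat \<Rightarrow> 'a) set"
    and y :: "nat \<Rightarrow> nat \<Rightarrow> 'a"
    and Y :: "nat \<Rightarrow> nat \<Rightarrow> (nat multiset \<Rightarrow> 'a set)"
    and i :: nat
    and l :: "nat \<Rightarrow> nat"
    and a :: "nat \<Rightarrow> 'a"
    and b :: "nat \<Rightarrow> (nat \<Rightarrow> nat) \<Rightarrow> 'a"
  assumes local_ring: "noetherian_local_ring A \<mm>"
    and dim: "krull_dim A = enat d"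
    and I_primary: "is_primary_to A \<mm> I"
    and Q_parameter: "system_of_parameters A \<mm> d x" "Q = Idl\<^bsub>A\<^esub> (x ` {1..d})"
    and Q_reduction: "is_reduction A Q I"
    and I_gens: "d \<le> n" "x ` {1..n} \<subseteq> carrier A"
      "I = Q <+>\<^bsub>A\<^esub> Idl\<^bsub>A\<^esub> (x ` {d+1..n})"
      "n = min_num_gens A (ideal_module A I)"
    and phi: "is_canonical_map A \<mm> I n x \<phi>"
    and y_Gen: "\<And>k j. k \<ge> 2 \<Longrightarrow> j \<in> {1..u_num A Q I k} \<Longrightarrow> y k j \<in> Gen A n x k"
    and y_min: "\<And>k. k \<ge> 2 \<Longrightarrow> min_gen_system A (red_quot A Q I k) (u_num A Q I k)
        (\<lambda>j. ideal_prod A Q (ideal_pow A I (k - 1)) +>\<^bsub>A\<^esub> y k j)"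
    and Y_monomial: "\<And>k j. k \<ge> 2 \<Longrightarrow> j \<in> {1..u_num A Q I k} \<Longrightarrow>
        Y k j \<in> monomials_of_degree (residue_field A \<mm>) {1..n} k"
    and Y_phi: "\<And>k j. k \<ge> 2 \<Longrightarrow> j \<in> {1..u_num A Q I k} \<Longrightarrow>
        \<phi> (Y k j) = fiber_elt A \<mm> I (y k j) k"
    and i: "2 \<le> i" "i \<le> reduction_number A Q I + 1"
    and l: "l \<in> tuples i n"
      "(\<Otimes>\<^bsub>A\<^esub>s\<in>{1..i}. x (l s)) \<in> Gen A n x i - MinGen A Q I y i"
    and coeffs: "admissible_coeffs A Q I d n x y i l a b"
  shows "Zpoly A \<mm> Q I d n Y i l a b \<in> a_kernel (KX A \<mm> n) (fiber_cone A \<mm> I) \<phi>"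
proof -
  \<comment> \<open>Keeps the index set \<open>{1..n}\<close>, a parameter of the polynomial ring, in one syntactic form.\<close>
  note One_nat_def [simp del]
  interpret L: noetherian_local_ring A \<mm> by (rule local_ring)
  have cA: "cring A" by (rule L.is_cring)
  have I_sub: "I \<subseteq> carrier A"
    using I_primary ideal.Icarr by (fastforce simp: is_primary_to_def primary_ideal_def)
  interpret fiber_cone_setting A \<mm> I
    by unfold_locales (use I_sub L.Icarr in auto)
  interpret K: cring "A Quot \<mm>" by (rule L.quotient_is_cring[OF cA])
  let ?KX = "KX A \<mm> n"
  let ?G = "\<lambda>i l. \<Otimes>\<^bsub>A\<^esub>s\<in>{1..i}. x (l s)" and ?H = "\<lambda>i l. \<Otimes>\<^bsub>?KX\<^esub>s\<in>{1..i}. Xvar A \<mm> (l s)"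
  let ?U = "{1..u_num A Q I i}" and ?T = "tuples (i - 1) n"
  interpret \<phi>: ring_hom_cring ?KX F \<phi>
    using phi by (simp add: ring_hom_cring_def ring_hom_cring_axioms_def K.mpoly_ring_cring
        proj.S.is_cring is_canonical_map_def)
  have phi_const: "\<phi> (res_const A \<mm> c) = fib c 0" if "c \<in> carrier A" for c
    using phi that by (simp add: is_canonical_map_def)
  have phi_var: "\<phi> (Xvar A \<mm> j) = fib (x j) 1" if "j \<in> {1..n}" for j
    using phi that by (simp add: is_canonical_map_def)
  have const_KX: "res_const A \<mm> c \<in> carrier ?KX" if "c \<in> carrier A" for c
    using that by (intro K.const_in_mpoly_ring) (simp add: ring_hom_closed[OF L.rcos_ring_hom])
  have var_KX: "Xvar A \<mm> j \<in> carrier ?KX" if "j \<in> {1..n}" for j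
    using that by (rule K.var_in_mpoly_ring)

  \<comment> \<open>Needed so that every \<open>x\<^sub>j t\<close> belongs to the Rees algebra.\<close>
  have x_I: "x j \<in> I" if j: "j \<in> {1..n}" for j
  proof (cases "j \<le> d")
    case True
    have "x ` {1..d} \<subseteq> carrier A" using I_gens(1,2) by fastforce
    from L.genideal_self[OF this] have "x j \<in> Q"
      using Q_parameter(2) True j by auto
    then show ?thesis using Q_reduction by (auto simp: is_reduction_def)
  next
    case False
    have sub: "x ` {1..d} \<subseteq> carrier A" "x ` {d+1..n} \<subseteq> carrier A" using I_gens(1,2) by fastforce+
    then have "x j \<in> Idl\<^bsub>A\<^esub> (x ` {d+1..n})"
      using L.genideal_self[OF sub(2)] False j by auto
    moreover have "\<zero>\<^bsub>A\<^esub> \<in> Q"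
      using additive_subgroup.zero_closed[OF ideal.axioms(1)[OF L.genideal_ideal[OF sub(1)]]]
        Q_parameter(2) by simp
    moreover have "x j = \<zero>\<^bsub>A\<^esub> \<oplus>\<^bsub>A\<^esub> x j"
    proof -
      have "x j \<in> carrier A" using I_gens(2) j by blast
      then show ?thesis by simp
    qed
    ultimately show ?thesis unfolding I_gens(3) set_add_def' by blast
  qed

  have prod_part: "?G k q \<in> rees_part k" and prod_KX: "?H k q \<in> carrier ?KX"
    and phi_prod: "\<phi> (?H k q) = fib (?G k q) k" if q: "q \<in> tuples k n" for k q
  proof -
    have q': "q s \<in> {1..n}" if "s \<in> {1..k}" for s
      using q that by (auto simp: PiE_def)
    then have xq: "x (q s) \<in> I" if "s \<in> {1..k}" for s
      using that x_I by blast
    have X: "(\<lambda>s. Xvar A \<mm> (q s)) \<in> {1..k} \<rightarrow> carrier ?KX"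
      using q' var_KX by blast
    then show "?H k q \<in> carrier ?KX" by (rule \<phi>.R.finprod_closed)
    show "?G k q \<in> rees_part k" using fib_finprod(1)[of "{1..k}", OF xq] by simp
    have "\<phi> (?H k q) = (\<Otimes>\<^bsub>F\<^esub>s\<in>{1..k}. \<phi> (Xvar A \<mm> (q s)))"
      using \<phi>.hom_finprod[OF X] by (simp add: comp_def)
    also have "\<dots> = (\<Otimes>\<^bsub>F\<^esub>s\<in>{1..k}. fib (x (q s)) 1)"
      using phi_var q' fib_closed[OF rees_part_1[OF xq]] by (intro proj.S.finprod_cong') auto
    also have "\<dots> = fib (?G k q) k"
      using fib_finprod(2)[of "{1..k}", OF xq] by simp
    finally show "\<phi> (?H k q) = fib (?G k q) k" .
  qed

  have a: "\<And>j. j \<in> ?U \<Longrightarrow> a j \<in> carrier A"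
    and b: "\<And>p q. p \<in> {1..d} \<Longrightarrow> q \<in> ?T \<Longrightarrow> b p q \<in> carrier A"
    using coeffs by (auto simp: admissible_coeffs_def)

  \<comment> \<open>The summands of the relation in \<open>A\<close>, and (primed) the corresponding summands of \<open>Z\<close>.\<close>
  define f where "f = (\<lambda>j. a j \<otimes>\<^bsub>A\<^esub> y i j)"
  define f' where "f' = (\<lambda>j. res_const A \<mm> (a j) \<otimes>\<^bsub>?KX\<^esub> Y i j)"
  define g where "g = (\<lambda>p q. b p q \<otimes>\<^bsub>A\<^esub> (x p \<otimes>\<^bsub>A\<^esub> ?G (i - 1) q))"
  define g' where "g' = (\<lambda>p q. res_const A \<mm> (b p q) \<otimes>\<^bsub>?KX\<^esub> (Xvar A \<mm> p \<otimes>\<^bsub>?KX\<^esub> ?H (i - 1) q))"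

  have f: "f j \<in> rees_part i \<and> f' j \<in> carrier ?KX \<and> \<phi> (f' j) = fib (f j) i" if j: "j \<in> ?U" for j
  proof -
    have y: "y i j \<in> rees_part i"
      using y_Gen[OF i(1) j] prod_part by (auto simp: Gen_def)
    have Y: "Y i j \<in> carrier ?KX"
      using Y_monomial[OF i(1) j] K.monomial_in_mpoly_ring by (auto simp: monomials_of_degree_def)
    show ?thesis
      using rees_part_mult[OF rees_part_0[OF a[OF j]] y] fib_mult[OF rees_part_0[OF a[OF j]] y]
        Y const_KX[OF a[OF j]] phi_const[OF a[OF j]] Y_phi[OF i(1) j]
      by (simp add: f_def f'_def)
  qed

  have g: "g p q \<in> rees_part i \<and> g' p q \<in> carrier ?KX \<and> \<phi> (g' p q) = fib (g p q) i"
    if p: "p \<in> {1..d}" and q: "q \<in> ?T" for p q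
  proof -
    have pn: "p \<in> {1..n}" using p I_gens(1) by auto
    \<comment> \<open>\<open>x\<^sub>p\<close> has degree 1 and the remaining product degree \<open>i - 1\<close>.\<close>
    have i1: "1 + (i - 1) = i" using i(1) by simp
    note xp = rees_part_1[OF x_I[OF pn]]
    note w = rees_part_mult[OF xp prod_part[OF q], unfolded i1]
    note bb = rees_part_0[OF b[OF p q]]
    have "fib (g p q) (0 + i) = fib (b p q) 0 \<otimes>\<^bsub>F\<^esub> (fib (x p) 1 \<otimes>\<^bsub>F\<^esub> fib (?G (i - 1) q) (i - 1))"
      unfolding g_def fib_mult[OF bb w] fib_mult[OF xp prod_part[OF q], unfolded i1] ..
    then show ?thesis
      using rees_part_mult[OF bb w] const_KX[OF b[OF p q]] var_KX[OF pn] prod_KX[OF q]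
        phi_const[OF b[OF p q]] phi_var[OF pn] phi_prod[OF q]
      by (simp add: g_def g'_def)
  qed

  \<comment> \<open>The correspondence between summands passes to sums; the inner and the outer sum over
    \<open>b\<close> are both instances, with index types that differ.\<close>
  have transfer: "(\<Oplus>\<^bsub>A\<^esub>s\<in>S. h s) \<in> rees_part i \<and>
      (\<Oplus>\<^bsub>?KX\<^esub>s\<in>S. h' s) \<in> carrier ?KX \<and>
      \<phi> (\<Oplus>\<^bsub>?KX\<^esub>s\<in>S. h' s) = fib (\<Oplus>\<^bsub>A\<^esub>s\<in>S. h s) i"
    if h: "\<And>s. s \<in> S \<Longrightarrow> h s \<in> rees_part i \<and> h' s \<in> carrier ?KX \<and> \<phi> (h' s) = fib (h s) i"
    for S :: "'s set" and h h'
  proof -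
    have h': "h' \<in> S \<rightarrow> carrier ?KX" using h by blast
    have "\<phi> (\<Oplus>\<^bsub>?KX\<^esub>s\<in>S. h' s) = (\<Oplus>\<^bsub>F\<^esub>s\<in>S. \<phi> (h' s))"
      using \<phi>.hom_finsum[OF h'] by (simp add: comp_def)
    also have "\<dots> = (\<Oplus>\<^bsub>F\<^esub>s\<in>S. fib (h s) i)"
      using h fib_closed by (intro proj.S.finsum_cong') auto
    also have "\<dots> = fib (\<Oplus>\<^bsub>A\<^esub>s\<in>S. h s) i"
      using fib_finsum(2)[of S h] h by auto
    finally show ?thesis
      using h' fib_finsum(1)[of S h i] h \<phi>.R.finsum_closed[OF h'] by auto
  qed

  define P where "P = ?G i l"
  define S where "S = (\<Oplus>\<^bsub>A\<^esub>j\<in>?U. f j)"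
  define T where "T = (\<Oplus>\<^bsub>A\<^esub>p\<in>{1..d}. \<Oplus>\<^bsub>A\<^esub>q\<in>?T. g p q)"
  define S' where "S' = (\<Oplus>\<^bsub>?KX\<^esub>j\<in>?U. f' j)"
  define T' where "T' = (\<Oplus>\<^bsub>?KX\<^esub>p\<in>{1..d}. \<Oplus>\<^bsub>?KX\<^esub>q\<in>?T. g' p q)"
  have P: "P \<in> rees_part i" "?H i l \<in> carrier ?KX" "\<phi> (?H i l) = fib P i"
    using prod_part[OF l(1)] prod_KX[OF l(1)] phi_prod[OF l(1)] by (simp_all add: P_def)
  have S: "S \<in> rees_part i" "S' \<in> carrier ?KX" "\<phi> S' = fib S i"
    using transfer[of ?U f f', OF f] by (simp_all add: S_def S'_def)
  have T: "T \<in> rees_part i" "T' \<in> carrier ?KX" "\<phi> T' = fib T i"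
    using transfer[of "{1..d}" "\<lambda>p. \<Oplus>\<^bsub>A\<^esub>q\<in>?T. g p q" "\<lambda>p. \<Oplus>\<^bsub>?KX\<^esub>q\<in>?T. g' p q", OF transfer[OF g]]
    by (simp_all add: T_def T'_def)
  have Z: "Zpoly A \<mm> Q I d n Y i l a b = ?H i l \<ominus>\<^bsub>?KX\<^esub> S' \<ominus>\<^bsub>?KX\<^esub> T'"
    by (simp add: Zpoly_def S'_def T'_def f'_def g'_def)

  have PST: "P \<ominus>\<^bsub>A\<^esub> S = T"
    using coeffs unfolding admissible_coeffs_def P_def S_def T_def f_def g_def by blast
  have carr: "P \<in> carrier A" "S \<in> carrier A" "T \<in> carrier A"
    using P(1) S(1) T(1) by (simp_all add: rees_part_def)
  have "P = T \<oplus>\<^bsub>A\<^esub> S"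
    unfolding PST[symmetric] using carr by (simp add: L.minus_eq L.a_assoc L.l_neg)
  then have "fib P i = fib T i \<oplus>\<^bsub>F\<^esub> fib S i"
    using fib_add[OF T(1) S(1)] by simp
  moreover have fib_carr: "fib S i \<in> carrier F" "fib T i \<in> carrier F"
    using S(1) T(1) fib_closed by auto
  ultimately have "fib P i \<ominus>\<^bsub>F\<^esub> fib S i = fib T i"
    by (simp add: proj.S.minus_eq proj.S.a_assoc proj.S.r_neg)
  then have "fib P i \<ominus>\<^bsub>F\<^esub> fib S i \<ominus>\<^bsub>F\<^esub> fib T i = \<zero>\<^bsub>F\<^esub>"
    using fib_carr by (simp add: proj.S.r_right_minus_eq)
  then have phi_Z: "\<phi> (?H i l \<ominus>\<^bsub>?KX\<^esub> S' \<ominus>\<^bsub>?KX\<^esub> T') = \<zero>\<^bsub>F\<^esub>"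
    by (simp only: \<phi>.hom_sub \<phi>.R.minus_closed P S T)
  have Z_KX: "?H i l \<ominus>\<^bsub>?KX\<^esub> S' \<ominus>\<^bsub>?KX\<^esub> T' \<in> carrier ?KX"
    by (simp only: \<phi>.R.minus_closed P S T)
  show ?thesis
    unfolding Z a_kernel_def' using phi_Z Z_KX by blast
qed

end
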